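(* Let $T=\{1243,2413,3142\}$ and let $F_T(x)=\sum_{n\ge0}|S_n(T)|x^n$. Then, as formal power series, $$F_T(x)=\frac{1-x(1-x)C(x)-\sqrt{1-5x+10x^2-5x^3-x(1-x)(1+x)C(x)}}{2x(1-x)},$$ where $C(x)=\frac{1-\sqrt{1-4x}}{2x}$.
   Context: $S_n$ is the set of permutations of $[n]$ ($S_0$ contains the empty permutation). A permutation avoids a pattern $\tau$ if it has no subsequence order-isomorphic to $\tau$; $S_n(T)$ is the set of permutations in $S_n$ avoiding every pattern in $T$. $C(x)$ is the Catalan generating function. *)

theory Defs
  imports
    Complex_Main
    "HOL-Library.Sublist"
    "HOL-Combinatorics.Multiset_Permutations"
    "HOL-Computational_Algebra.Formal_Power_Series"
begin

(* Permutations of {1..n} are represented in one-line notation, as the lists in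
   permutations_of_set {1..n}; for n = 0 this is the set containing only []. *)

definition order_isomorphic :: "nat list \<Rightarrow> nat list \<Rightarrow> bool" where
  "order_isomorphic xs ys \<longleftrightarrow> length xs = length ys \<and>
     (\<forall>i<length xs. \<forall>j<length xs. xs ! i < xs ! j \<longleftrightarrow> ys ! i < ys ! j)"

definition avoids :: "nat list \<Rightarrow> nat list \<Rightarrow> bool" where
  "avoids \<pi> \<tau> \<longleftrightarrow> \<not> (\<exists>\<sigma>. subseq \<sigma> \<pi> \<and> order_isomorphic \<sigma> \<tau>)"

definition avoiding_perms :: "nat \<Rightarrow> nat list set \<Rightarrow> nat list set" where
  "avoiding_perms n T = {\<pi> \<in> permutations_of_set {1..n}. \<forall>\<tau>\<in>T. avoids \<pi> \<tau>}"

definition avoiding_gf :: "nat list set \<Rightarrow> real fps" where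
  "avoiding_gf T = Abs_fps (\<lambda>n. real (card (avoiding_perms n T)))"

(* For a series with constant term 1, this is its unique square root with
   constant term 1. *)
definition fps_sqrt :: "real fps \<Rightarrow> real fps" where
  "fps_sqrt f = fps_radical root 2 f"

lemma fps_sqrt_nth_0: "fps_nth (fps_sqrt f) 0 = sqrt (fps_nth f 0)"
  by (simp add: fps_sqrt_def sqrt_def)

lemma fps_sqrt_squared: "fps_nth f 0 = 1 \<Longrightarrow> (fps_sqrt f)\<^sup>2 = f"
  using power_radical[of f root 1] by (simp add: fps_sqrt_def numeral_2_eq_2)

definition catalan_gf :: "real fps" where
  "catalan_gf = (1 - fps_sqrt (1 - 4 * fps_X)) / (2 * fps_X)"

(* Division of formal power series discards the low-order terms when the divisor
   does not divide the dividend; the following lemma shows that the division in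
   catalan_gf is exact. *)
lemma catalan_gf_mult: "2 * fps_X * catalan_gf = 1 - fps_sqrt (1 - 4 * fps_X)"
proof -
  define N where "N = 1 - fps_sqrt (1 - 4 * fps_X)"
  have "fps_nth N 0 = 0"
    by (simp add: N_def fps_sqrt_nth_0)
  then have "N = 2 * fps_X * (fps_const (1/2) * fps_shift 1 N)"
    by (auto simp: fps_eq_iff numeral_fps_const mult.assoc fps_mult_left_const_nth)
  then have "2 * fps_X dvd N"
    by (rule dvdI)
  then show ?thesis
    by (simp add: catalan_gf_def N_def)
qed

(* The same for the quotient whose numerator has the form 1 - X g - sqrt f. *)
lemma fps_quotient_exact:
  fixes f g :: "real fps"
  assumes "fps_nth f 0 = 1"
  shows "2 * fps_X * (1 - fps_X) dvd 1 - fps_X * g - fps_sqrt f"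
proof -
  define N where "N = 1 - fps_X * g - fps_sqrt f"
  have "fps_nth N 0 = 0"
    using assms by (simp add: N_def fps_sqrt_nth_0)
  then have "N = 2 * fps_X * (fps_const (1/2) * fps_shift 1 N)"
    by (auto simp: fps_eq_iff numeral_fps_const mult.assoc fps_mult_left_const_nth)
  also have "\<dots> = 2 * fps_X * (1 - fps_X) *
      (inverse (1 - fps_X) * (fps_const (1/2) * fps_shift 1 N))"
  proof -
    have "(1 - fps_X) * inverse (1 - fps_X :: real fps) = 1"
      by (rule inverse_mult_eq_1') simp
    then have "M = M * ((1 - fps_X) * inverse (1 - fps_X))" for M :: "real fps"
      by simp
    from this[of "2 * fps_X * (fps_const (1/2) * fps_shift 1 N)"] show ?thesis
      by (simp only: ac_simps)
  qed
  finally show ?thesis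
    unfolding N_def by (rule dvdI)
qed

end

theory Submission
  imports Defs
begin

text \<open>
  Every permutation splits uniquely as a skew sum of a skew-indecomposable permutation and a
  remainder. As the patterns in question are themselves skew-indecomposable, their avoidance classes
  are closed under skew sums, so \<open>F = 1 + I F\<close>, where \<open>I\<close> counts the nonempty skew-indecomposable
  members. Those ending in their maximum contribute \<open>x F\<close>. Any other one has length at least 2 and,
  being separable, is a direct sum; avoiding 1243 then forces the first summand to be decreasing and
  the second to avoid 132. Since 132-avoiders ending in their maximum are counted by \<open>x C\<close>, these
  contribute \<open>x / (1 - x) (C - 1 - x C) = x (C - 1 / (1 - x))\<close>. The same argument for 132 alone,
  where the skew-indecomposables are exactly those ending in their maximum, gives \<open>C = 1 + x C\<^sup>2\<close>.
  Hence \<open>F = (1 - x) (1 + x F (F + C))\<close>, whose discriminant is the radicand.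
\<close>

section \<open>Skew sums\<close>

text \<open>Compares raw values, so that blocks of a permutation need no relabelling:
  \<open>above \<alpha> \<beta>\<close> makes \<open>\<alpha> @ \<beta>\<close> a skew sum, and
  \<open>above \<beta> \<alpha>\<close> makes it a direct sum.\<close>

definition above :: "nat list \<Rightarrow> nat list \<Rightarrow> bool" where
  "above \<alpha> \<beta> \<longleftrightarrow> (\<forall>x\<in>set \<alpha>. \<forall>y\<in>set \<beta>. y < x)"

text \<open>Excluding the empty list ensures that splitting off a first component always removes at
  least one entry.\<close>

definition skew_indec :: "nat list \<Rightarrow> bool" where
  "skew_indec \<pi> \<longleftrightarrow> \<pi> \<noteq> [] \<and>
     (\<forall>\<alpha> \<beta>. \<pi> = \<alpha> @ \<beta> \<longrightarrow> \<alpha> \<noteq> [] \<longrightarrow> \<beta> \<noteq> [] \<longrightarrow> \<not> above \<alpha> \<beta>)"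

lemma above_append_right [simp]: "above \<alpha> (\<beta> @ \<gamma>) \<longleftrightarrow> above \<alpha> \<beta> \<and> above \<alpha> \<gamma>"
  by (auto simp: above_def)

lemma above_append_left [simp]: "above (\<alpha> @ \<beta>) \<gamma> \<longleftrightarrow> above \<alpha> \<gamma> \<and> above \<beta> \<gamma>"
  by (auto simp: above_def)

lemma above_Nil [simp]: "above \<alpha> []" "above [] \<beta>"
  by (auto simp: above_def)

lemma above_map:
  assumes "strict_mono f"
  shows "above (map f \<alpha>) (map f \<beta>) \<longleftrightarrow> above \<alpha> \<beta>"
  using assms by (auto simp: above_def strict_mono_less)

lemma skew_indec_map:
  assumes "strict_mono f"
  shows "skew_indec (map f \<pi>) \<longleftrightarrow> skew_indec \<pi>"
proof -
  have "map f \<pi> = \<alpha> @ \<beta> \<longleftrightarrow> (\<exists>\<alpha>' \<beta>'. \<pi> = \<alpha>' @ \<beta>' \<and> \<alpha> = map f \<alpha>' \<and> \<beta> = map f \<beta>')" for \<alpha> \<beta>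
    by (auto simp: map_eq_append_conv)
  then show ?thesis
    unfolding skew_indec_def by (simp add: above_map[OF assms] flip: ex_simps all_simps)
qed

text \<open>If some cut is possible, induction applies to its left block; the rest of that block and
  the right block both lie below the component found.\<close>

lemma skew_indec_prefix_exists:
  "\<pi> \<noteq> [] \<Longrightarrow> \<exists>\<alpha> \<beta>. \<pi> = \<alpha> @ \<beta> \<and> skew_indec \<alpha> \<and> above \<alpha> \<beta>"
proof (induction "length \<pi>" arbitrary: \<pi> rule: less_induct)
  case less
  show ?case
  proof (cases "skew_indec \<pi>")
    case True
    then show ?thesis by (intro exI[of _ \<pi>] exI[of _ "[]"]) simp
  next
    case False
    then obtain \<alpha> \<beta> where ab: "\<pi> = \<alpha> @ \<beta>" "\<alpha> \<noteq> []" "\<beta> \<noteq> []" "above \<alpha> \<beta>"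
      using less.prems by (auto simp: skew_indec_def)
    then obtain \<alpha>1 \<alpha>2 where "\<alpha> = \<alpha>1 @ \<alpha>2" "skew_indec \<alpha>1" "above \<alpha>1 \<alpha>2"
      using less.hyps[of \<alpha>] by auto
    with ab show ?thesis
      by (intro exI[of _ \<alpha>1] exI[of _ "\<alpha>2 @ \<beta>"]) simp
  qed
qed

text \<open>If one prefix were longer than the other, the end of the shorter one would be a
  forbidden cut inside the longer one.\<close>

lemma skew_indec_prefix_unique:
  assumes "\<alpha> @ \<beta> = \<alpha>' @ \<beta>'" "skew_indec \<alpha>" "skew_indec \<alpha>'" "above \<alpha> \<beta>" "above \<alpha>' \<beta>'"
  shows "\<alpha> = \<alpha>'" "\<beta> = \<beta>'"
proof -
  have "\<alpha> = \<alpha>' \<and> \<beta> = \<beta>'"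
    using assms(1) unfolding append_eq_append_conv2
    using assms(2-) by (auto simp: skew_indec_def)
  then show "\<alpha> = \<alpha>'" "\<beta> = \<beta>'" by auto
qed

section \<open>Pattern avoidance under relabelling and skew sums\<close>

lemma order_isomorphic_map:
  assumes "strict_mono f"
  shows "order_isomorphic (map f xs) ys \<longleftrightarrow> order_isomorphic xs ys"
  using assms by (auto simp: order_isomorphic_def strict_mono_less)

lemma avoids_map:
  assumes "strict_mono f"
  shows "avoids (map f \<pi>) \<tau> \<longleftrightarrow> avoids \<pi> \<tau>"
proof -
  have "subseq \<sigma> (map f \<pi>) \<longleftrightarrow> (\<exists>\<sigma>'. subseq \<sigma>' \<pi> \<and> \<sigma> = map f \<sigma>')" for \<sigma>
    by (auto simp: subseq_conv_nths nths_map)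
  then show ?thesis
    using order_isomorphic_map[OF assms] by (auto simp: avoids_def)
qed

lemma avoids_subseq: "avoids \<pi> \<tau> \<Longrightarrow> subseq \<sigma> \<pi> \<Longrightarrow> avoids \<sigma> \<tau>"
  unfolding avoids_def using subseq_order.order_trans by blast

text \<open>A cut of \<open>\<sigma>\<close> at position \<open>k\<close> carries over to a cut of
  \<open>\<tau>\<close> at the same position, since only comparisons between positions are
  involved.\<close>

lemma order_isomorphic_skew_indec:
  assumes "order_isomorphic \<sigma> \<tau>" "skew_indec \<tau>"
  shows "skew_indec \<sigma>"
  unfolding skew_indec_def
proof (intro conjI allI impI notI)
  show "\<sigma> = [] \<Longrightarrow> False"
    using assms by (auto simp: order_isomorphic_def skew_indec_def)
next
  fix \<alpha> \<beta> assume h: "\<sigma> = \<alpha> @ \<beta>" "\<alpha> \<noteq> []" "\<beta> \<noteq> []" "above \<alpha> \<beta>"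
  define k where "k = length \<alpha>"
  have k: "0 < k" "k < length \<sigma>" using h by (auto simp: k_def)
  have len: "length \<tau> = length \<sigma>" using assms(1) by (simp add: order_isomorphic_def)
  have "\<tau> ! j < \<tau> ! i" if "i < k" "k \<le> j" "j < length \<sigma>" for i j
  proof -
    have "\<sigma> ! i \<in> set \<alpha>" "\<sigma> ! j \<in> set \<beta>"
      using that h(1) k by (auto simp: nth_append k_def)
    then have "\<sigma> ! j < \<sigma> ! i" using h(4) by (auto simp: above_def)
    then show ?thesis using assms(1) that k by (auto simp: order_isomorphic_def)
  qed
  then have "above (take k \<tau>) (drop k \<tau>)"
    using k len by (auto simp: above_def in_set_conv_nth)
  moreover have "take k \<tau> \<noteq> []" "drop k \<tau> \<noteq> []" using k len by auto
  ultimately show False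
    using assms(2) by (metis append_take_drop_id skew_indec_def)
qed

lemma subseq_set: "subseq xs ys \<Longrightarrow> set xs \<subseteq> set ys"
  by (auto simp: subseq_conv_nths dest: in_set_nthsD)

text \<open>An occurrence of \<open>\<tau>\<close> splits into a part in \<open>\<alpha>\<close> and
  a lower part in \<open>\<beta>\<close>; as the pattern is indecomposable, one of the two is
  empty.\<close>

lemma avoids_skew_sum:
  assumes "above \<alpha> \<beta>" "skew_indec \<tau>"
  shows "avoids (\<alpha> @ \<beta>) \<tau> \<longleftrightarrow> avoids \<alpha> \<tau> \<and> avoids \<beta> \<tau>"
proof
  assume "avoids (\<alpha> @ \<beta>) \<tau>"
  then show "avoids \<alpha> \<tau> \<and> avoids \<beta> \<tau>"
    by (auto intro: avoids_subseq subseq_rev_drop_many subseq_drop_many)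
next
  assume h: "avoids \<alpha> \<tau> \<and> avoids \<beta> \<tau>"
  show "avoids (\<alpha> @ \<beta>) \<tau>"
    unfolding avoids_def
  proof (rule notI, elim exE conjE)
    fix \<sigma> assume s: "subseq \<sigma> (\<alpha> @ \<beta>)" "order_isomorphic \<sigma> \<tau>"
    then obtain \<sigma>1 \<sigma>2 where s12: "\<sigma> = \<sigma>1 @ \<sigma>2" "subseq \<sigma>1 \<alpha>" "subseq \<sigma>2 \<beta>"
      by (auto simp: subseq_append_iff)
    have "above \<sigma>1 \<sigma>2"
      using assms(1) subseq_set[OF s12(2)] subseq_set[OF s12(3)] by (auto simp: above_def)
    then have "\<sigma>1 = [] \<or> \<sigma>2 = []"
      using order_isomorphic_skew_indec[OF s(2) assms(2)] s12(1) by (auto simp: skew_indec_def)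
    then show False
      using h s s12 by (auto simp: avoids_def)
  qed
qed

section \<open>Shifted permutations\<close>

lemma finite_avoiding_perms [simp]: "finite (avoiding_perms n T)"
  by (simp add: avoiding_perms_def)

lemma avoiding_perms_iff:
  "\<pi> \<in> avoiding_perms n T \<longleftrightarrow> distinct \<pi> \<and> set \<pi> = {1..n} \<and> (\<forall>\<tau>\<in>T. avoids \<pi> \<tau>)"
  by (auto simp: avoiding_perms_def permutations_of_set_def)

lemma length_avoiding_perms: "\<pi> \<in> avoiding_perms n T \<Longrightarrow> length \<pi> = n"
  by (auto simp: avoiding_perms_iff dest: distinct_card)

lemma strict_mono_add_right: "strict_mono (\<lambda>x::nat. x + m)"
  by (simp add: strict_mono_def)

definition shift :: "nat \<Rightarrow> nat list \<Rightarrow> nat list" where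
  "shift m = map (\<lambda>x. x + m)"

lemma length_shift [simp]: "length (shift m \<pi>) = length \<pi>"
  by (simp add: shift_def)

lemma shift_eq_iff [simp]: "shift m \<pi> = shift m \<sigma> \<longleftrightarrow> \<pi> = \<sigma>"
  by (simp add: shift_def inj_map_eq_map inj_on_def)

lemma distinct_shift [simp]: "distinct (shift m \<pi>) \<longleftrightarrow> distinct \<pi>"
  by (simp add: shift_def distinct_map inj_on_def)

lemma set_shift: "set (shift m \<pi>) = {m + 1..m + k} \<longleftrightarrow> set \<pi> = {1..k}"
proof -
  have "{m + 1..m + k} = (\<lambda>x. x + m) ` {1..k}"
    by (simp add: add.commute)
  then show ?thesis
    unfolding shift_def list.set_map by (simp only:) (rule inj_image_eq_iff, simp add: inj_on_def)
qed

lemma avoids_shift [simp]: "avoids (shift m \<pi>) \<tau> \<longleftrightarrow> avoids \<pi> \<tau>"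
  unfolding shift_def by (rule avoids_map[OF strict_mono_add_right])

lemma skew_indec_shift [simp]: "skew_indec (shift m \<pi>) \<longleftrightarrow> skew_indec \<pi>"
  unfolding shift_def by (rule skew_indec_map[OF strict_mono_add_right])

text \<open>With \<open>shift_perm\<close>, this identifies the avoiding arrangements of an interval
  of \<open>k\<close> values with \<open>avoiding_perms k T\<close>, so that a block can be counted
  independently of its position.\<close>

lemma unshift_perm:
  fixes \<pi> :: "nat list"
  assumes "distinct \<pi>" "set \<pi> = {m + 1..m + k}" "\<forall>\<tau>\<in>T. avoids \<pi> \<tau>"
  obtains \<alpha> where "\<alpha> \<in> avoiding_perms k T" "\<pi> = shift m \<alpha>"
proof
  \<comment> \<open>All entries exceed \<open>m\<close>, so the truncated subtraction is
    exact.\<close>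
  define \<alpha> where "\<alpha> = map (\<lambda>x. x - m) \<pi>"
  show eq: "\<pi> = shift m \<alpha>"
    using assms(2) by (auto simp: \<alpha>_def shift_def o_def intro!: map_idI[symmetric])
  show "\<alpha> \<in> avoiding_perms k T"
    using assms unfolding eq avoiding_perms_iff set_shift by simp
qed

lemma shift_perm:
  assumes "\<alpha> \<in> avoiding_perms k T"
  shows "distinct (shift m \<alpha>)" "set (shift m \<alpha>) = {m + 1..m + k}" "\<forall>\<tau>\<in>T. avoids (shift m \<alpha>) \<tau>"
  using assms unfolding avoiding_perms_iff set_shift by simp_all

text \<open>An element of \<open>X\<close> below \<open>Max Y\<close> would contradict the third
  assumption, so \<open>Y\<close> is an initial segment of \<open>{1..n}\<close> and
  \<open>X\<close> is its complement.\<close>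

lemma lower_part_interval:
  fixes X Y :: "nat set"
  assumes "X \<union> Y = {1..n}" "X \<inter> Y = {}" "\<And>x y. x \<in> X \<Longrightarrow> y \<in> Y \<Longrightarrow> y < x"
  shows "Y = {1..card Y}" "X = {card Y + 1..n}" "card Y + card X = n"
proof -
  have fin: "finite X" "finite Y" using assms(1) by (metis finite_Un finite_atLeastAtMost)+
  show card: "card Y + card X = n"
    using card_Un_disjoint[OF fin assms(2)] assms(1) by simp
  show Y: "Y = {1..card Y}"
  proof (cases "Y = {}")
    case False
    define m where "m = Max Y"
    have m: "m \<in> Y" "\<And>y. y \<in> Y \<Longrightarrow> y \<le> m" using False fin by (auto simp: m_def)
    have "Y = {1..m}"
    proof (intro equalityI subsetI)
      fix y assume "y \<in> Y" then show "y \<in> {1..m}" using m assms(1) by auto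
    next
      fix y assume y: "y \<in> {1..m}"
      then have "y \<in> X \<union> Y" using m(1) assms(1) by (metis Un_iff atLeastAtMost_iff order_trans)
      then show "y \<in> Y" using assms(3)[of y m] m y by auto
    qed
    then show ?thesis by simp
  qed simp
  have "X = {1..n} - {1..card Y}" using assms(1,2) Y by blast
  then show "X = {card Y + 1..n}" by auto
qed

text \<open>The lengths of the blocks of a skew sum determine their value sets. Exchanging the two
  blocks gives the same for direct sums.\<close>

lemma above_perm_parts:
  assumes "distinct (\<alpha> @ \<beta>)" "set (\<alpha> @ \<beta>) = {1..n}" "above \<alpha> \<beta>"
  shows "set \<beta> = {1..length \<beta>}" "set \<alpha> = {length \<beta> + 1..length \<beta> + length \<alpha>}"
    "length \<alpha> + length \<beta> = n"
proof -
  have len: "card (set \<alpha>) = length \<alpha>" "card (set \<beta>) = length \<beta>"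
    using assms(1) by (simp_all add: distinct_card)
  have *: "set \<alpha> \<union> set \<beta> = {1..n}" "set \<alpha> \<inter> set \<beta> = {}"
    "\<And>x y. x \<in> set \<alpha> \<Longrightarrow> y \<in> set \<beta> \<Longrightarrow> y < x"
    using assms by (auto simp: above_def)
  show "set \<beta> = {1..length \<beta>}" "length \<alpha> + length \<beta> = n"
    using lower_part_interval(1,3)[OF *] unfolding len by simp_all
  then show "set \<alpha> = {length \<beta> + 1..length \<beta> + length \<alpha>}"
    using lower_part_interval(2)[OF *] unfolding len by (simp add: add.commute)
qed

section \<open>Counting by the first skew component\<close>

definition indec_perms :: "nat \<Rightarrow> nat list set \<Rightarrow> nat list set" where
  "indec_perms n T = {\<pi> \<in> avoiding_perms n T. skew_indec \<pi>}"

lemma finite_indec_perms [simp]: "finite (indec_perms n T)"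
  by (simp add: indec_perms_def)

text \<open>Cutting off the first skew-indecomposable block is a bijection onto pairs of smaller
  permutations: the cut exists and is unique, and avoidance of the whole is avoidance of both
  blocks.\<close>

lemma card_avoiding_perms_skew:
  assumes T: "\<forall>\<tau>\<in>T. skew_indec \<tau>" and n: "0 < n"
  shows "card (avoiding_perms n T) =
    (\<Sum>k=1..n. card (indec_perms k T) * card (avoiding_perms (n - k) T))"
proof -
  define D where "D = (SIGMA k:{1..n}. indec_perms k T \<times> avoiding_perms (n - k) T)"
  \<comment> \<open>The first block has length \<open>k\<close> and occupies the top
    \<open>k\<close> values, hence the shift by \<open>n - k\<close>.\<close>
  define f where "f = (\<lambda>(k, \<alpha>, \<beta>). shift (n - k) \<alpha> @ \<beta> :: nat list)"
  have ab: "above (shift (n - k) \<alpha>) \<beta> \<and> skew_indec (shift (n - k) \<alpha>) \<and> length \<alpha> = k \<and>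
      k \<in> {1..n} \<and> \<alpha> \<in> avoiding_perms k T \<and> \<beta> \<in> avoiding_perms (n - k) T"
    if "(k, \<alpha>, \<beta>) \<in> D" for k \<alpha> \<beta>
  proof -
    from that have *: "skew_indec (shift (n - k) \<alpha>)" "k \<in> {1..n}" "\<alpha> \<in> avoiding_perms k T"
      "\<beta> \<in> avoiding_perms (n - k) T"
      by (auto simp: D_def indec_perms_def)
    moreover have "length \<alpha> = k" using *(3) by (rule length_avoiding_perms)
    moreover have "above (shift (n - k) \<alpha>) \<beta>"
      using *(4) unfolding above_def shift_perm(2)[OF *(3)] avoiding_perms_iff by auto
    ultimately show ?thesis by blast
  qed
  have "inj_on f D"
  proof (rule inj_onI)
    fix p q assume pq: "p \<in> D" "q \<in> D" "f p = f q"
    obtain k \<alpha> \<beta> k' \<alpha>' \<beta>' where p: "p = (k, \<alpha>, \<beta>)" and q: "q = (k', \<alpha>', \<beta>')"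
      by (metis prod_cases3)
    note h = pq[unfolded p q]
    have eq: "shift (n - k) \<alpha> = shift (n - k') \<alpha>'" "\<beta> = \<beta>'"
      using skew_indec_prefix_unique[of "shift (n - k) \<alpha>" \<beta>
          "shift (n - k') \<alpha>'" \<beta>'] ab[OF h(1)] ab[OF h(2)] h(3)
      by (simp_all add: f_def)
    have k: "k = k'" using eq(1) ab[OF h(1)] ab[OF h(2)] by (metis length_shift)
    have "\<alpha> = \<alpha>'" using eq(1) unfolding k by simp
    then show "p = q" using k eq(2) p q by simp
  qed
  moreover have "f ` D = avoiding_perms n T"
  proof (intro equalityI subsetI)
    fix \<pi> assume "\<pi> \<in> f ` D"
    then obtain k \<alpha> \<beta> where D: "(k, \<alpha>, \<beta>) \<in> D" and pi: "\<pi> = shift (n - k) \<alpha> @ \<beta>"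
      by (auto simp: f_def)
    from ab[OF D] have ab: "above (shift (n - k) \<alpha>) \<beta>" "k \<in> {1..n}" "\<alpha> \<in> avoiding_perms k T"
      "\<beta> \<in> avoiding_perms (n - k) T" by auto
    note sh = shift_perm[OF ab(3), of "n - k"]
    have b: "set \<beta> = {1..n - k}" "distinct \<beta>" "\<forall>\<tau>\<in>T. avoids \<beta> \<tau>"
      using ab(4) unfolding avoiding_perms_iff by blast+
    have "set \<pi> = {1..n}"
      unfolding pi set_append sh b using ab(2) by auto
    moreover have "distinct \<pi>"
      unfolding pi distinct_append sh(2) b(1) using sh(1) b(2) by simp
    moreover have "\<forall>\<tau>\<in>T. avoids \<pi> \<tau>"
      using T sh(3) b(3) avoids_skew_sum[OF ab(1)] unfolding pi by blast
    ultimately show "\<pi> \<in> avoiding_perms n T"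
      unfolding avoiding_perms_iff by blast
  next
    fix \<pi> assume pi: "\<pi> \<in> avoiding_perms n T"
    then have ne: "\<pi> \<noteq> []" using n length_avoiding_perms by fastforce
    then obtain \<alpha> \<beta> where d: "\<pi> = \<alpha> @ \<beta>" "skew_indec \<alpha>" "above \<alpha> \<beta>"
      using skew_indec_prefix_exists by blast
    have "distinct (\<alpha> @ \<beta>)" "set (\<alpha> @ \<beta>) = {1..n}"
      using pi unfolding d(1) avoiding_perms_iff by blast+
    note parts = above_perm_parts[OF this d(3)]
    have av: "\<forall>\<tau>\<in>T. avoids \<alpha> \<tau> \<and> avoids \<beta> \<tau>" "distinct \<alpha>" "distinct \<beta>"
      using pi T avoids_skew_sum[OF d(3)] d(1) by (auto simp: avoiding_perms_iff)
    obtain \<alpha>' where a: "\<alpha>' \<in> avoiding_perms (length \<alpha>) T" "\<alpha> = shift (length \<beta>) \<alpha>'"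
      using unshift_perm[of \<alpha> "length \<beta>" "length \<alpha>" T] av parts(2) by blast
    have "skew_indec \<alpha>'"
      using d(2) a(2) by simp
    moreover have "\<beta> \<in> avoiding_perms (length \<beta>) T"
      using parts(1) av unfolding avoiding_perms_iff by blast
    moreover have "length \<alpha> \<in> {1..n}" "n - length \<alpha> = length \<beta>"
      using parts(3) d(2) by (auto simp: skew_indec_def Suc_le_eq)
    ultimately have "(length \<alpha>, \<alpha>', \<beta>) \<in> D"
      using a(1) by (simp add: D_def indec_perms_def)
    moreover have "f (length \<alpha>, \<alpha>', \<beta>) = \<pi>"
      using a(2) d(1) \<open>n - length \<alpha> = length \<beta>\<close> by (simp add: f_def)
    ultimately show "\<pi> \<in> f ` D" by (metis imageI)
  qed
  ultimately have "card (avoiding_perms n T) = card D"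
    using card_image by fastforce
  then show ?thesis
    by (simp add: D_def card_SigmaI card_cartesian_product)
qed

section \<open>Permutations ending in their maximum\<close>

text \<open>An occurrence using the new entry \<open>m\<close> would have it as last letter, but the
  last letter of \<open>\<tau>\<close> is exceeded by another letter, while nothing exceeds
  \<open>m\<close>.\<close>

lemma avoids_snoc_max:
  assumes "\<forall>x\<in>set \<pi>. x < m" "\<tau> \<noteq> []" "\<exists>y\<in>set \<tau>. last \<tau> < y"
  shows "avoids (\<pi> @ [m]) \<tau> \<longleftrightarrow> avoids \<pi> \<tau>"
proof
  assume "avoids (\<pi> @ [m]) \<tau>"
  then show "avoids \<pi> \<tau>" by (rule avoids_subseq) (simp add: subseq_rev_drop_many)
next
  assume h: "avoids \<pi> \<tau>"
  show "avoids (\<pi> @ [m]) \<tau>"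
    unfolding avoids_def
  proof (rule notI, elim exE conjE)
    fix \<sigma> assume s: "subseq \<sigma> (\<pi> @ [m])" "order_isomorphic \<sigma> \<tau>"
    have len: "length \<sigma> = length \<tau>" and ne: "\<sigma> \<noteq> []"
      using s(2) assms(2) by (auto simp: order_isomorphic_def)
    obtain i where i: "i < length \<tau>" "last \<tau> < \<tau> ! i"
      using assms(3) by (auto simp: in_set_conv_nth)
    then have "\<sigma> ! (length \<sigma> - 1) < \<sigma> ! i"
      using s(2) len ne assms(2) by (auto simp: order_isomorphic_def last_conv_nth)
    moreover have "\<sigma> ! i \<le> m"
    proof -
      have "\<sigma> ! i \<in> set \<sigma>" using i len by simp
      then have "\<sigma> ! i \<in> set (\<pi> @ [m])" using subseq_set[OF s(1)] by blast
      then show ?thesis using assms(1) by (auto simp: less_imp_le)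
    qed
    ultimately have "last \<sigma> < m" using ne by (simp add: last_conv_nth)
    moreover obtain \<sigma>1 \<sigma>2 where "\<sigma> = \<sigma>1 @ \<sigma>2" "subseq \<sigma>1 \<pi>" "subseq \<sigma>2 [m]"
      using s(1) by (auto simp: subseq_append_iff)
    moreover from this have "\<sigma>2 = [] \<or> \<sigma>2 = [m]"
      by (cases \<sigma>2) (auto split: if_splits)
    ultimately show False using h s(2) by (auto simp: avoids_def)
  qed
qed

lemma last_max_perms:
  assumes "\<forall>\<tau>\<in>T. \<tau> \<noteq> [] \<and> (\<exists>y\<in>set \<tau>. last \<tau> < y)" "0 < n"
  shows "{\<pi> \<in> avoiding_perms n T. last \<pi> = n} = (\<lambda>\<pi>. \<pi> @ [n]) ` avoiding_perms (n - 1) T"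
proof (intro equalityI subsetI)
  fix \<pi> assume "\<pi> \<in> {\<pi> \<in> avoiding_perms n T. last \<pi> = n}"
  then have pi: "\<pi> \<in> avoiding_perms n T" "last \<pi> = n" by auto
  then have "\<pi> \<noteq> []" using assms(2) length_avoiding_perms by fastforce
  then obtain \<alpha> where a: "\<pi> = \<alpha> @ [n]" using pi(2) by (metis append_butlast_last_id)
  have d: "distinct \<alpha>" "n \<notin> set \<alpha>" "insert n (set \<alpha>) = {1..n}"
    using pi a by (auto simp: avoiding_perms_iff)
  have set: "set \<alpha> = {1..n} - {n}" using d by blast
  also have "{1..n} - {n} = {1..n - 1}" by auto
  finally have "set \<alpha> = {1..n - 1}" .
  moreover have "\<forall>\<tau>\<in>T. avoids \<alpha> \<tau>"
    using pi(1) a by (auto simp: avoiding_perms_iff intro: avoids_subseq subseq_rev_drop_many)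
  ultimately show "\<pi> \<in> (\<lambda>\<pi>. \<pi> @ [n]) ` avoiding_perms (n - 1) T"
    using a d by (auto simp: avoiding_perms_iff)
next
  fix \<pi> assume "\<pi> \<in> (\<lambda>\<pi>. \<pi> @ [n]) ` avoiding_perms (n - 1) T"
  then obtain \<alpha> where a: "\<pi> = \<alpha> @ [n]" "\<alpha> \<in> avoiding_perms (n - 1) T" by auto
  then have s: "set \<alpha> = {1..n - 1}" "distinct \<alpha>" "\<forall>\<tau>\<in>T. avoids \<alpha> \<tau>" by (auto simp: avoiding_perms_iff)
  have "\<forall>x\<in>set \<alpha>. x < n" using s assms(2) by auto
  moreover have "insert n {1..n - 1} = {1..n}" using assms(2) by auto
  ultimately show "\<pi> \<in> {\<pi> \<in> avoiding_perms n T. last \<pi> = n}"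
    using s a(1) assms(1) avoids_snoc_max[of \<alpha> n] by (auto simp: avoiding_perms_iff)
qed

lemma card_last_max_perms:
  assumes "\<forall>\<tau>\<in>T. \<tau> \<noteq> [] \<and> (\<exists>y\<in>set \<tau>. last \<tau> < y)" "0 < n"
  shows "card {\<pi> \<in> avoiding_perms n T. last \<pi> = n} = card (avoiding_perms (n - 1) T)"
  unfolding last_max_perms[OF assms] by (rule card_image) (simp add: inj_on_def)

text \<open>Any cut would put the last entry strictly below the first. Equality is allowed in order
  to cover singletons.\<close>

lemma skew_indec_hd_less_last:
  assumes "\<pi> \<noteq> []" "hd \<pi> \<le> last \<pi>"
  shows "skew_indec \<pi>"
  unfolding skew_indec_def
proof (intro conjI allI impI notI)
  fix \<alpha> \<beta> assume h: "\<pi> = \<alpha> @ \<beta>" "\<alpha> \<noteq> []" "\<beta> \<noteq> []" "above \<alpha> \<beta>"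
  then have "last \<beta> < hd \<alpha>" by (simp add: above_def)
  then show False using assms(2) h by simp
qed (use assms in simp)

lemma skew_indec_last_max:
  assumes "\<pi> \<in> avoiding_perms n T" "last \<pi> = n" "0 < n"
  shows "skew_indec \<pi>"
proof (rule skew_indec_hd_less_last)
  show ne: "\<pi> \<noteq> []" using assms length_avoiding_perms by fastforce
  then show "hd \<pi> \<le> last \<pi>" using hd_in_set[OF ne] assms by (auto simp: avoiding_perms_iff)
qed

text \<open>Permutations ending in \<open>n\<close> are automatically skew-indecomposable, and
  deleting this entry leaves an arbitrary member of the class.\<close>

lemma card_indec_perms:
  assumes "\<forall>\<tau>\<in>T. \<tau> \<noteq> [] \<and> (\<exists>y\<in>set \<tau>. last \<tau> < y)" "0 < n"
  shows "card (indec_perms n T) =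
    card (avoiding_perms (n - 1) T) + card {\<pi> \<in> indec_perms n T. last \<pi> \<noteq> n}"
proof -
  have "indec_perms n T = {\<pi> \<in> avoiding_perms n T. last \<pi> = n} \<union> {\<pi> \<in> indec_perms n T. last \<pi> \<noteq> n}"
    using skew_indec_last_max assms(2) by (auto simp: indec_perms_def)
  then have "card (indec_perms n T) =
      card ({\<pi> \<in> avoiding_perms n T. last \<pi> = n} \<union> {\<pi> \<in> indec_perms n T. last \<pi> \<noteq> n})"
    by (rule arg_cong)
  also have "\<dots> = card {\<pi> \<in> avoiding_perms n T. last \<pi> = n} +
      card {\<pi> \<in> indec_perms n T. last \<pi> \<noteq> n}"
    by (rule card_Un_disjoint) auto
  finally show ?thesis using card_last_max_perms[OF assms] by simp
qed

section \<open>Separable permutations\<close>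

text \<open>This and the next three predicates give an occurrence by a chain of strict inequalities
  that lists its letters by increasing value, the form in which occurrences are built and refuted
  below.\<close>

definition contains_132 :: "nat list \<Rightarrow> bool" where
  "contains_132 \<pi> \<longleftrightarrow> (\<exists>a b c. subseq [a, b, c] \<pi> \<and> a < c \<and> c < b)"

definition contains_1243 :: "nat list \<Rightarrow> bool" where
  "contains_1243 \<pi> \<longleftrightarrow> (\<exists>a b c d. subseq [a, b, c, d] \<pi> \<and> a < b \<and> b < d \<and> d < c)"

definition contains_2413 :: "nat list \<Rightarrow> bool" where
  "contains_2413 \<pi> \<longleftrightarrow> (\<exists>a b c d. subseq [a, b, c, d] \<pi> \<and> c < a \<and> a < d \<and> d < b)"

definition contains_3142 :: "nat list \<Rightarrow> bool" where
  "contains_3142 \<pi> \<longleftrightarrow> (\<exists>a b c d. subseq [a, b, c, d] \<pi> \<and> b < d \<and> d < a \<and> a < c)"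

lemma order_isomorphic_132: "order_isomorphic \<sigma> [1, 3, 2] \<longleftrightarrow> (\<exists>a b c. \<sigma> = [a, b, c] \<and> a < c \<and> c < b)"
  by (auto simp: order_isomorphic_def length_Suc_conv less_Suc_eq eval_nat_numeral)

lemma order_isomorphic_1243: "order_isomorphic \<sigma> [1, 2, 4, 3] \<longleftrightarrow>
    (\<exists>a b c d. \<sigma> = [a, b, c, d] \<and> a < b \<and> b < d \<and> d < c)"
  by (auto simp: order_isomorphic_def length_Suc_conv less_Suc_eq eval_nat_numeral)

lemma order_isomorphic_2413: "order_isomorphic \<sigma> [2, 4, 1, 3] \<longleftrightarrow>
    (\<exists>a b c d. \<sigma> = [a, b, c, d] \<and> c < a \<and> a < d \<and> d < b)"
  by (auto simp: order_isomorphic_def length_Suc_conv less_Suc_eq eval_nat_numeral)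

lemma order_isomorphic_3142: "order_isomorphic \<sigma> [3, 1, 4, 2] \<longleftrightarrow>
    (\<exists>a b c d. \<sigma> = [a, b, c, d] \<and> b < d \<and> d < a \<and> a < c)"
  by (auto simp: order_isomorphic_def length_Suc_conv less_Suc_eq eval_nat_numeral)

lemma avoids_132: "avoids \<pi> [1, 3, 2] \<longleftrightarrow> \<not> contains_132 \<pi>"
  unfolding avoids_def contains_132_def order_isomorphic_132 by blast

lemma avoids_1243: "avoids \<pi> [1, 2, 4, 3] \<longleftrightarrow> \<not> contains_1243 \<pi>"
  unfolding avoids_def contains_1243_def order_isomorphic_1243 by blast

lemma avoids_2413: "avoids \<pi> [2, 4, 1, 3] \<longleftrightarrow> \<not> contains_2413 \<pi>"
  unfolding avoids_def contains_2413_def order_isomorphic_2413 by blast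

lemma avoids_3142: "avoids \<pi> [3, 1, 4, 2] \<longleftrightarrow> \<not> contains_3142 \<pi>"
  unfolding avoids_def contains_3142_def order_isomorphic_3142 by blast

lemma skew_indec_132: "skew_indec [1, 3, 2]"
  by (auto simp: skew_indec_def above_def Cons_eq_append_conv)

lemma skew_indec_patterns:
  "skew_indec [1, 2, 4, 3]" "skew_indec [2, 4, 1, 3]" "skew_indec [3, 1, 4, 2]"
  by (auto simp: skew_indec_def above_def Cons_eq_append_conv)

text \<open>Induction on the list: either the first entry is extreme and can be cut off alone, or
  the tail has a cut by induction, which is then moved to accommodate the first entry.\<close>

lemma separable_decomposes:
  assumes "distinct \<pi>" "2 \<le> length \<pi>" "\<not> contains_2413 \<pi>" "\<not> contains_3142 \<pi>"
  shows "\<exists>\<alpha> \<beta>. \<pi> = \<alpha> @ \<beta> \<and> \<alpha> \<noteq> [] \<and> \<beta> \<noteq> [] \<and> (above \<alpha> \<beta> \<or> above \<beta> \<alpha>)"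
  using assms
proof (induction \<pi>)
  case Nil
  then show ?case by simp
next
  case (Cons x \<pi>)
  have x: "x \<notin> set \<pi>" using Cons.prems by simp
  have ne: "\<pi> \<noteq> []" using Cons.prems(2) by auto
  show ?case
  proof (cases "above [x] \<pi> \<or> above \<pi> [x]")
    case True
    then show ?thesis using ne by (intro exI[of _ "[x]"] exI[of _ \<pi>]) auto
  next
    case False
    then have mid: "\<not> above [x] \<pi>" "\<not> above \<pi> [x]" by auto
    have "length \<pi> \<noteq> 1"
    proof
      assume "length \<pi> = 1"
      then obtain y where "\<pi> = [y]" by (auto simp: length_Suc_conv)
      then show False using mid x by (auto simp: above_def)
    qed
    then have "2 \<le> length \<pi>" using ne by (cases \<pi>) (auto simp: Suc_le_eq)
    moreover have "\<not> contains_2413 \<pi>" "\<not> contains_3142 \<pi>"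
      using Cons.prems(3,4) unfolding contains_2413_def contains_3142_def by (meson list_emb_Cons)+
    ultimately obtain \<alpha> \<beta> where ab: "\<pi> = \<alpha> @ \<beta>" "\<alpha> \<noteq> []" "\<beta> \<noteq> []" "above \<alpha> \<beta> \<or> above \<beta> \<alpha>"
      using Cons.IH Cons.prems(1) by auto
    txt \<open>
      If \<open>x\<close> falls inside the range of \<open>\<beta>\<close>, the entries of \<open>\<beta>\<close> on the side of \<open>\<alpha>\<close> must all come
      before the others, as otherwise \<open>x\<close>, \<open>a\<close> and two entries of \<open>\<beta>\<close> form a 3142 or a 2413.
    \<close>
    obtain a where a: "a \<in> set \<alpha>" using ab(2) by (cases \<alpha>) auto
    have sub: "subseq [x, a, b, c] (x # \<pi>)" if "subseq [b, c] \<beta>" for b c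
    proof -
      have "subseq ([a] @ [b, c]) (\<alpha> @ \<beta>)"
        by (rule list_emb_append_mono) (use a that in \<open>auto simp: subseq_singleton_left\<close>)
      then show ?thesis using ab(1) by simp
    qed
    show ?thesis
      using ab(4)
    proof
      assume ba: "above \<beta> \<alpha>"
      show ?thesis
      proof (cases "above \<beta> [x]")
        case True
        then show ?thesis using ab ba
          by (intro exI[of _ "x # \<alpha>"] exI[of _ \<beta>]) (auto simp: above_def)
      next
        case False
        then obtain b where "b \<in> set \<beta>" "b < x" using x ab(1) by (force simp: above_def)
        \<comment> \<open>All of \<open>\<alpha>\<close> lies below \<open>b\<close>, hence below
          \<open>x\<close>.\<close>
        then have ax: "a' < x" if "a' \<in> set \<alpha>" for a'
          using that ba unfolding above_def by (meson order.strict_trans)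
        \<comment> \<open>The new cut is placed before the first entry \<open>c\<close> of
          \<open>\<beta>\<close> above \<open>x\<close>; the claim is that no later entry drops
          below \<open>x\<close>.\<close>
        define \<gamma> where "\<gamma> = takeWhile (\<lambda>y. y < x) \<beta>"
        define \<delta> where "\<delta> = dropWhile (\<lambda>y. y < x) \<beta>"
        have gd: "\<beta> = \<gamma> @ \<delta>" by (simp add: \<gamma>_def \<delta>_def)
        have g: "y < x" if "y \<in> set \<gamma>" for y using that by (auto simp: \<gamma>_def dest: set_takeWhileD)
        have "\<delta> \<noteq> []"
        proof
          assume "\<delta> = []"
          then have "above [x] \<pi>" using ax g gd ab(1) by (auto simp: above_def)
          then show False using mid by simp
        qed
        then obtain c \<delta>' where d: "\<delta> = c # \<delta>'" by (cases \<delta>) auto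
        have "\<not> c < x" using d by (metis \<delta>_def hd_dropWhile list.distinct(1) list.sel(1))
        then have c: "x < c" using x ab(1) gd d by auto
        have "x < y" if y: "y \<in> set \<delta>" for y
        proof (rule ccontr)
          assume "\<not> x < y"
          moreover have "y \<noteq> x" using y x ab(1) gd by auto
          ultimately have y': "y < x" "y \<in> set \<delta>'" using y d c by auto
          have "subseq [c, y] \<beta>"
            using y'(2) unfolding gd d by (intro subseq_drop_many) (simp add: subseq_singleton_left)
          then have "subseq [x, a, c, y] (x # \<pi>)" by (rule sub)
          \<comment> \<open>Now \<open>a < y < x < c\<close>, so \<open>x, a, c, y\<close> is a
            3142.\<close>
          moreover have "a < y" using ba a y gd by (auto simp: above_def)
          ultimately show False
            using Cons.prems(4) y'(1) c unfolding contains_3142_def by blast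
        qed
        then have "above \<delta> (x # \<alpha> @ \<gamma>)"
          using ax g by (fastforce simp: above_def)
        then show ?thesis using \<open>\<delta> \<noteq> []\<close> ab(1) gd
          by (intro exI[of _ "x # \<alpha> @ \<gamma>"] exI[of _ \<delta>]) auto
      qed
    next
      \<comment> \<open>Mirror image of the first case with the order of values reversed, which
        turns 3142 into 2413.\<close>
      assume ba: "above \<alpha> \<beta>"
      show ?thesis
      proof (cases "above [x] \<beta>")
        case True
        then show ?thesis using ab ba
          by (intro exI[of _ "x # \<alpha>"] exI[of _ \<beta>]) (auto simp: above_def)
      next
        case False
        then obtain b where "b \<in> set \<beta>" "x < b" using x ab(1) by (force simp: above_def)
        then have ax: "x < a'" if "a' \<in> set \<alpha>" for a'
          using that ba unfolding above_def by (meson order.strict_trans)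
        define \<gamma> where "\<gamma> = takeWhile (\<lambda>y. x < y) \<beta>"
        define \<delta> where "\<delta> = dropWhile (\<lambda>y. x < y) \<beta>"
        have gd: "\<beta> = \<gamma> @ \<delta>" by (simp add: \<gamma>_def \<delta>_def)
        have g: "x < y" if "y \<in> set \<gamma>" for y using that by (auto simp: \<gamma>_def dest: set_takeWhileD)
        have "\<delta> \<noteq> []"
        proof
          assume "\<delta> = []"
          then have "above \<pi> [x]" using ax g gd ab(1) by (auto simp: above_def)
          then show False using mid by simp
        qed
        then obtain c \<delta>' where d: "\<delta> = c # \<delta>'" by (cases \<delta>) auto
        have "\<not> x < c" using d by (metis \<delta>_def hd_dropWhile list.distinct(1) list.sel(1))
        then have c: "c < x" using x ab(1) gd d by auto
        have "y < x" if y: "y \<in> set \<delta>" for y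
        proof (rule ccontr)
          assume "\<not> y < x"
          moreover have "y \<noteq> x" using y x ab(1) gd by auto
          ultimately have y': "x < y" "y \<in> set \<delta>'" using y d c by auto
          have "subseq [c, y] \<beta>"
            using y'(2) unfolding gd d by (intro subseq_drop_many) (simp add: subseq_singleton_left)
          then have "subseq [x, a, c, y] (x # \<pi>)" by (rule sub)
          moreover have "y < a" using ba a y gd by (auto simp: above_def)
          ultimately show False
            using Cons.prems(3) y'(1) c unfolding contains_2413_def by blast
        qed
        then have "above (x # \<alpha> @ \<gamma>) \<delta>"
          using ax g by (fastforce simp: above_def)
        then show ?thesis using \<open>\<delta> \<noteq> []\<close> ab(1) gd
          by (intro exI[of _ "x # \<alpha> @ \<gamma>"] exI[of _ \<delta>]) auto
      qed
    qed
  qed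
qed

section \<open>Direct sums with a decreasing first summand\<close>

lemma subseq_pair_nth:
  assumes "i < j" "j < length xs"
  shows "subseq [xs ! i, xs ! j] xs"
proof -
  have "xs ! i \<in> set (take j xs)" "xs ! j \<in> set (drop j xs)"
    using assms by (auto simp: in_set_conv_nth intro: exI[of _ i] exI[of _ 0])
  then have "subseq ([xs ! i] @ [xs ! j]) (take j xs @ drop j xs)"
    by (intro list_emb_append_mono) (simp_all add: subseq_singleton_left)
  then show ?thesis by simp
qed

lemma subseq_sorted_wrt: "subseq xs ys \<Longrightarrow> sorted_wrt P ys \<Longrightarrow> sorted_wrt P xs"
  by (induction rule: list_emb.induct) (auto dest: subseq_set)

text \<open>An occurrence splits into a decreasing part \<open>us\<close> in \<open>\<alpha>\<close>
  and a part \<open>vs\<close> in \<open>\<beta>\<close> with larger values. This leaves in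
  \<open>us\<close> at most the letter 1 of 1243, and nothing of 2413 or 3142, so
  \<open>\<beta>\<close> would contain a 132: the letters 243, 243 and 142 respectively.\<close>

lemma decreasing_sum_avoids:
  assumes dec: "sorted_wrt (>) \<alpha>" and ab: "above \<beta> \<alpha>" and \<beta>: "\<not> contains_132 \<beta>"
  shows "\<not> contains_1243 (\<alpha> @ \<beta>)" "\<not> contains_2413 (\<alpha> @ \<beta>)" "\<not> contains_3142 (\<alpha> @ \<beta>)"
proof -
  have up: "\<not> y < x" if "subseq us \<alpha>" "subseq vs \<beta>" "x \<in> set us" "y \<in> set vs" for us vs x y
    using that ab subseq_set[of us] subseq_set[of vs] unfolding above_def
    by (meson not_less_iff_gr_or_eq subset_iff)
  have no: "\<not> (a < c \<and> c < b)" if "subseq [a, b, c] \<beta>" for a b c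
    using \<beta> that unfolding contains_132_def by blast
  note sub = subseq_order.order_trans[of _ _ \<beta>]
  show "\<not> contains_1243 (\<alpha> @ \<beta>)"
  proof
    assume "contains_1243 (\<alpha> @ \<beta>)"
    then obtain a b c d us vs where h: "a < b" "b < d" "d < c" "[a, b, c, d] = us @ vs"
      and s: "subseq us \<alpha>" "subseq vs \<beta>"
      unfolding contains_1243_def subseq_append_iff by blast
    have "sorted_wrt (>) us" using s(1) dec by (rule subseq_sorted_wrt)
    with h(4) h(1-3) have "us = [] \<and> vs = [a, b, c, d] \<or> us = [a] \<and> vs = [b, c, d]"
      by (auto simp: Cons_eq_append_conv)
    then have "subseq [b, c, d] \<beta>" using s(2) sub[of "[b, c, d]" "[a, b, c, d]"] by auto
    then show False using no h by blast
  qed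
  show "\<not> contains_2413 (\<alpha> @ \<beta>)"
  proof
    assume "contains_2413 (\<alpha> @ \<beta>)"
    then obtain a b c d us vs where h: "c < a" "a < d" "d < b" "[a, b, c, d] = us @ vs"
      and s: "subseq us \<alpha>" "subseq vs \<beta>"
      unfolding contains_2413_def subseq_append_iff by blast
    have "sorted_wrt (>) us" using s(1) dec by (rule subseq_sorted_wrt)
    \<comment> \<open>A nonempty \<open>us\<close> would be \<open>[a]\<close>, because
      \<open>a < b\<close>; but then \<open>c\<close> in \<open>vs\<close> is smaller than
      \<open>a\<close>.\<close>
    with h(4) h(1-3) have "vs = [a, b, c, d]"
      using up[OF s, of a c] by (auto simp: Cons_eq_append_conv)
    then have "subseq [a, b, d] \<beta>" using s(2) sub[of "[a, b, d]" "[a, b, c, d]"] by auto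
    then show False using no h by blast
  qed
  show "\<not> contains_3142 (\<alpha> @ \<beta>)"
  proof
    assume "contains_3142 (\<alpha> @ \<beta>)"
    then obtain a b c d us vs where h: "b < d" "d < a" "a < c" "[a, b, c, d] = us @ vs"
      and s: "subseq us \<alpha>" "subseq vs \<beta>"
      unfolding contains_3142_def subseq_append_iff by blast
    have "sorted_wrt (>) us" using s(1) dec by (rule subseq_sorted_wrt)
    \<comment> \<open>Here \<open>us\<close> could also be the descent \<open>[a, b]\<close>, but
      \<open>d\<close> in \<open>vs\<close> is smaller than \<open>a\<close> in either case.\<close>
    with h(4) h(1-3) have "vs = [a, b, c, d]"
      using up[OF s, of a d] by (auto simp: Cons_eq_append_conv)
    then have "subseq [b, c, d] \<beta>" using s(2) sub[of "[b, c, d]" "[a, b, c, d]"] by auto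
    then show False using no[of b c d] h by auto
  qed
qed

definition decreasing :: "nat \<Rightarrow> nat list" where
  "decreasing k = rev [1..<Suc k]"

lemma decreasing_simps [simp]: "set (decreasing k) = {1..k}" "distinct (decreasing k)"
  "length (decreasing k) = k" "sorted_wrt (>) (decreasing k)"
  by (auto simp: decreasing_def sorted_wrt_rev simp del: upt_Suc)

lemma hd_decreasing: "0 < k \<Longrightarrow> hd (decreasing k) = k"
  by (auto simp: decreasing_def hd_rev)

lemma decreasing_unique:
  assumes "sorted_wrt (>) \<alpha>" "set \<alpha> = {1..k}"
  shows "\<alpha> = decreasing k"
proof -
  have "rev \<alpha> = [1..<Suc k]"
  proof (rule strict_sorted_equal)
    show "sorted_wrt (<) [1..<Suc k]" by (rule sorted_wrt_upt)
    show "sorted_wrt (<) (rev \<alpha>)" using assms(1) by (simp add: sorted_wrt_rev)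
    show "set (rev \<alpha>) = set [1..<Suc k]" unfolding set_rev assms(2) set_upt by auto
  qed
  then show ?thesis by (metis decreasing_def rev_rev_ident)
qed

text \<open>These are the possible second summands, up to a shift. Only \<open>1 \<le> m\<close> is
  used; at \<open>m = 0\<close> the condition concerns the unspecified
  \<open>last []\<close>.\<close>

definition perms_132_last_not_max :: "nat \<Rightarrow> nat list set" where
  "perms_132_last_not_max m = {\<beta> \<in> avoiding_perms m {[1, 3, 2]}. last \<beta> \<noteq> m}"

lemma increasing_pair_if_not_decreasing:
  assumes "distinct \<alpha>" "\<not> sorted_wrt (>) \<alpha>"
  shows "\<exists>a b. subseq [a, b] \<alpha> \<and> a < (b :: nat)"
proof -
  obtain i j where ij: "i < j" "j < length \<alpha>" "\<not> \<alpha> ! j < \<alpha> ! i"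
    using assms(2) by (auto simp: sorted_wrt_iff_nth_less)
  then have "\<alpha> ! i \<noteq> \<alpha> ! j" using assms(1) by (simp add: nth_eq_iff_index_eq)
  then show ?thesis using subseq_pair_nth[OF ij(1,2)] ij(3) by (meson linorder_neqE_nat)
qed

text \<open>A separable skew-indecomposable permutation of length at least 2 is a direct sum. Since
  \<open>n\<close> is not last, the second summand has a descent starting at \<open>n\<close>, which
  completes any ascent of the first summand to a 1243; any entry of the first summand completes a
  132 of the second to a 1243.\<close>

lemma indec_not_last_max_eq:
  fixes T
  defines "T \<equiv> {[1, 2, 4, 3], [2, 4, 1, 3], [3, 1, 4, 2]}"
  assumes n: "0 < n"
  shows "{\<pi> \<in> indec_perms n T. last \<pi> \<noteq> n} =
    (\<Union>m\<in>{1..<n}. (\<lambda>\<beta>. decreasing (n - m) @ shift (n - m) \<beta>) ` perms_132_last_not_max m)"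
proof (intro equalityI subsetI)
  fix \<pi> assume "\<pi> \<in> {\<pi> \<in> indec_perms n T. last \<pi> \<noteq> n}"
  then have pi: "\<pi> \<in> avoiding_perms n T" "skew_indec \<pi>" "last \<pi> \<noteq> n"
    by (auto simp: indec_perms_def)
  have set: "set \<pi> = {1..n}" and dist: "distinct \<pi>" and len: "length \<pi> = n"
    using pi(1) length_avoiding_perms by (auto simp: avoiding_perms_iff)
  have av: "\<not> contains_1243 \<pi>" "\<not> contains_2413 \<pi>" "\<not> contains_3142 \<pi>"
    using pi(1) unfolding avoiding_perms_iff T_def
    by (simp_all only: ball_simps avoids_1243 avoids_2413 avoids_3142 simp_thms)
  have "n \<noteq> 1"
  proof
    assume "n = 1"
    then obtain x where "\<pi> = [x]" using len by (auto simp: length_Suc_conv)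
    then show False using set pi(3) \<open>n = 1\<close> by simp
  qed
  then have "2 \<le> length \<pi>" using len n by linarith
  from separable_decomposes[OF dist this av(2,3)]
  obtain \<alpha> \<beta> where ab: "\<pi> = \<alpha> @ \<beta>" "\<alpha> \<noteq> []" "\<beta> \<noteq> []" "above \<beta> \<alpha>"
    using pi(2) unfolding skew_indec_def by blast
  \<comment> \<open>The blocks are exchanged because \<open>\<beta>\<close> holds the larger
    values.\<close>
  have "distinct (\<beta> @ \<alpha>)" "set (\<beta> @ \<alpha>) = {1..n}" using dist set ab(1) by auto
  note parts = above_perm_parts[OF this ab(4)]
  define m where "m = length \<beta>"
  define k where "k = length \<alpha>"
  have km: "m \<in> {1..<n}" "n - m = k" "k + m = n"
    using parts(3) ab(2,3) by (auto simp: m_def k_def Suc_le_eq)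
  \<comment> \<open>The pair \<open>n\<close>, \<open>last \<beta>\<close> is to serve as the
    letters 43 of a 1243.\<close>
  have "n \<in> set \<beta>" unfolding parts(2) using km by (auto simp: m_def k_def)
  moreover have last: "last \<beta> \<noteq> n" using pi(3) ab by simp
  ultimately have "n \<in> set (butlast \<beta>)"
    using append_butlast_last_id[OF ab(3)] by (metis Un_iff empty_iff set_ConsD set_append set_empty)
  then have "subseq ([n] @ [last \<beta>]) (butlast \<beta> @ [last \<beta>])"
    by (intro list_emb_append_mono) (simp_all add: subseq_singleton_left)
  then have nl: "subseq [n, last \<beta>] \<beta>" using ab(3) by simp
  have lastb: "last \<beta> \<in> set \<beta>" using ab(3) by simp
  then have ln: "last \<beta> < n" using last set ab(1) by (auto simp: order.strict_iff_order)
  have "sorted_wrt (>) \<alpha>"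
  proof (rule ccontr)
    assume "\<not> ?thesis"
    then obtain a b where *: "subseq [a, b] \<alpha>" "a < b"
      using increasing_pair_if_not_decreasing[of \<alpha>] dist ab(1) by auto
    have "b \<in> set \<alpha>" using subseq_set[OF *(1)] by simp
    then have "b < last \<beta>" using ab(4) lastb by (auto simp: above_def)
    moreover have "subseq ([a, b] @ [n, last \<beta>]) \<pi>"
      unfolding ab(1) by (intro list_emb_append_mono * nl)
    ultimately have "contains_1243 \<pi>"
      unfolding contains_1243_def using *(2) ln by (metis append_Cons append_Nil)
    then show False using av(1) by blast
  qed
  then have \<alpha>: "\<alpha> = decreasing k" using parts(1) by (intro decreasing_unique) (simp_all add: k_def)
  have "\<not> contains_132 \<beta>"
  proof
    assume "contains_132 \<beta>"
    then obtain b c d where *: "subseq [b, c, d] \<beta>" "b < d" "d < c" by (auto simp: contains_132_def)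
    \<comment> \<open>Any entry of \<open>\<alpha>\<close> can serve as the letter 1; the head is
      one choice.\<close>
    have "hd \<alpha> \<in> set \<alpha>" "b \<in> set \<beta>" using ab(2) subseq_set[OF *(1)] by auto
    then have "hd \<alpha> < b" using ab(4) by (auto simp: above_def)
    moreover have "subseq ([hd \<alpha>] @ [b, c, d]) \<pi>"
      unfolding ab(1) by (intro list_emb_append_mono *) (simp add: subseq_singleton_left ab(2))
    ultimately have "contains_1243 \<pi>"
      unfolding contains_1243_def using *(2,3) by (metis append_Cons append_Nil)
    then show False using av(1) by blast
  qed
  then have "\<forall>\<tau>\<in>{[1, 3, 2]}. avoids \<beta> \<tau>" unfolding avoids_132[symmetric] by blast
  moreover have "distinct \<beta>" using dist ab(1) by simp
  ultimately obtain \<beta>' where b: "\<beta>' \<in> avoiding_perms m {[1, 3, 2]}" "\<beta> = shift k \<beta>'"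
    using unshift_perm[of \<beta> k m] parts(2) unfolding m_def k_def by blast
  have "last \<beta>' \<noteq> m" using last b(2) ab(3) km(3) by (auto simp: shift_def last_map)
  then have "\<beta>' \<in> perms_132_last_not_max m" using b(1) by (simp add: perms_132_last_not_max_def)
  then show "\<pi> \<in> (\<Union>m\<in>{1..<n}. (\<lambda>\<beta>. decreasing (n - m) @ shift (n - m) \<beta>) ` perms_132_last_not_max m)"
    using km(1) ab(1) \<alpha> b(2) km(2) by (intro UN_I[of m]) auto
next
  fix \<pi> assume "\<pi> \<in> (\<Union>m\<in>{1..<n}. (\<lambda>\<beta>. decreasing (n - m) @ shift (n - m) \<beta>) ` perms_132_last_not_max m)"
  then obtain m \<beta> where m: "m \<in> {1..<n}" and b: "\<beta> \<in> avoiding_perms m {[1, 3, 2]}" "last \<beta> \<noteq> m"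
    and pi: "\<pi> = decreasing (n - m) @ shift (n - m) \<beta>"
    by (auto simp: perms_132_last_not_max_def)
  define k where "k = n - m"
  have k: "0 < k" "k + m = n" using m by (auto simp: k_def)
  have \<beta>: "set (shift k \<beta>) = {k + 1..k + m}" "distinct (shift k \<beta>)" "\<forall>\<tau>\<in>{[1,3,2]}. avoids (shift k \<beta>) \<tau>"
    using shift_perm[OF b(1), of k] by blast+
  note pi = pi[folded k_def]
  have ne: "\<beta> \<noteq> []" using length_avoiding_perms[OF b(1)] m by auto
  have ab: "above (shift k \<beta>) (decreasing k)"
    unfolding above_def \<beta>(1) by auto
  have "\<not> contains_132 (shift k \<beta>)" using \<beta>(3) avoids_132 by blast
  note av = decreasing_sum_avoids[OF decreasing_simps(4) ab this]
  have "{1..k} \<union> {k + 1..k + m} = {1..n}" using k by auto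
  then have "set \<pi> = {1..n}" unfolding pi set_append \<beta>(1) decreasing_simps .
  moreover have "distinct \<pi>" unfolding pi distinct_append \<beta>(1) using \<beta>(2) by simp
  moreover have "\<forall>\<tau>\<in>T. avoids \<pi> \<tau>"
    unfolding pi T_def using av by (simp only: ball_simps avoids_1243 avoids_2413 avoids_3142 simp_thms)
  ultimately have "\<pi> \<in> avoiding_perms n T" unfolding avoiding_perms_iff by blast
  moreover have "shift k \<beta> \<noteq> []" "decreasing k \<noteq> []"
    using ne k(1) by (metis length_0_conv length_shift, metis decreasing_simps(3) list.size(3) less_irrefl)
  \<comment> \<open>The first entry \<open>k\<close> is below the last entry, which gives
    skew-indecomposability; the last entry differs from \<open>n = k + m\<close> because
    \<open>last \<beta> \<noteq> m\<close>.\<close>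
  then have hl: "hd \<pi> = k" "last \<pi> = last \<beta> + k" 
    using ne k(1) by (simp_all add: pi hd_decreasing) (simp add: shift_def last_map)
  then have "skew_indec \<pi>"
    by (intro skew_indec_hd_less_last) (use ne pi in \<open>auto simp: shift_def\<close>)
  ultimately show "\<pi> \<in> {\<pi> \<in> indec_perms n T. last \<pi> \<noteq> n}"
    using hl b(2) k(2) by (simp add: indec_perms_def)
qed

section \<open>Counting the direct sums\<close>

lemma finite_perms_132_last_not_max [simp]: "finite (perms_132_last_not_max m)"
  by (simp add: perms_132_last_not_max_def)

lemma card_avoiding_132_Suc:
  "card (avoiding_perms (Suc m) {[1, 3, 2]}) = card (perms_132_last_not_max (Suc m)) + card (avoiding_perms m {[1, 3, 2]})"
proof -
  have "avoiding_perms (Suc m) {[1, 3, 2]} =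
      perms_132_last_not_max (Suc m) \<union> {\<pi> \<in> avoiding_perms (Suc m) {[1, 3, 2]}. last \<pi> = Suc m}"
    by (auto simp: perms_132_last_not_max_def)
  then have "card (avoiding_perms (Suc m) {[1, 3, 2]}) =
      card (perms_132_last_not_max (Suc m) \<union> {\<pi> \<in> avoiding_perms (Suc m) {[1, 3, 2]}. last \<pi> = Suc m})"
    by (rule arg_cong)
  also have "\<dots> = card (perms_132_last_not_max (Suc m)) + card {\<pi> \<in> avoiding_perms (Suc m) {[1, 3, 2]}. last \<pi> = Suc m}"
    by (rule card_Un_disjoint) (auto simp: perms_132_last_not_max_def)
  also have "card {\<pi> \<in> avoiding_perms (Suc m) {[1, 3, 2]}. last \<pi> = Suc m} =
      card (avoiding_perms m {[1, 3, 2]})"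
    using card_last_max_perms[of "{[1, 3, 2]}" "Suc m"] by simp
  finally show ?thesis .
qed

lemma card_avoiding_perms_0:
  assumes "[] \<notin> T"
  shows "card (avoiding_perms 0 T) = 1"
proof -
  have "avoids [] \<tau>" if "\<tau> \<in> T" for \<tau>
    using assms that by (auto simp: avoids_def order_isomorphic_def dest: list_emb_Nil2)
  then have "avoiding_perms 0 T = {[]}" by (auto simp: avoiding_perms_iff)
  then show ?thesis by simp
qed

text \<open>By \<open>card_avoiding_132_Suc\<close> each summand is a difference of consecutive
  counts of 132-avoiders, so the sum telescopes; the \<open>Suc\<close> is the term of the empty
  permutation.\<close>

lemma sum_card_perms_132_last_not_max:
  "Suc (\<Sum>m=1..<Suc n. card (perms_132_last_not_max m)) = card (avoiding_perms n {[1, 3, 2]})"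
proof (induction n)
  case 0
  then show ?case by (simp add: card_avoiding_perms_0)
next
  case (Suc n)
  have "(\<Sum>m=1..<Suc (Suc n). card (perms_132_last_not_max m)) = (\<Sum>m=1..<Suc n. card (perms_132_last_not_max m)) + card (perms_132_last_not_max (Suc n))"
    by (rule sum.atLeastLessThan_Suc) simp
  then show ?case using Suc card_avoiding_132_Suc[of n] by linarith
qed

text \<open>The first entry \<open>Suc n - m\<close> reveals \<open>m\<close>, so the union in
  \<open>indec_not_last_max_eq\<close> is disjoint and the telescoping sum applies.\<close>

lemma card_indec_not_last_max:
  "Suc (card {\<pi> \<in> indec_perms (Suc n) {[1, 2, 4, 3], [2, 4, 1, 3], [3, 1, 4, 2]}. last \<pi> \<noteq> Suc n}) =
    card (avoiding_perms n {[1, 3, 2]})"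
proof -
  let ?f = "\<lambda>m \<beta>. decreasing (Suc n - m) @ shift (Suc n - m) \<beta>"
  have hd: "hd (?f m \<beta>) = Suc n - m" if "m < Suc n" for m \<beta>
  proof -
    have "decreasing (Suc n - m) \<noteq> []"
      using that by (metis decreasing_simps(3) list.size(3) zero_less_diff less_irrefl)
    then show ?thesis using that by (simp add: hd_decreasing)
  qed
  have "card (\<Union>m\<in>{1..<Suc n}. ?f m ` perms_132_last_not_max m) = (\<Sum>m=1..<Suc n. card (?f m ` perms_132_last_not_max m))"
  proof (rule card_UN_disjoint)
    show "\<forall>i\<in>{1..<Suc n}. \<forall>j\<in>{1..<Suc n}. i \<noteq> j \<longrightarrow> ?f i ` perms_132_last_not_max i \<inter> ?f j ` perms_132_last_not_max j = {}"
    proof (intro ballI impI)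
      fix i j assume ij: "i \<in> {1..<Suc n}" "j \<in> {1..<Suc n}" "i \<noteq> j"
      have "?f i \<beta> \<noteq> ?f j \<gamma>" for \<beta> \<gamma>
      proof
        assume "?f i \<beta> = ?f j \<gamma>"
        then have "Suc n - i = Suc n - j" using hd[of i \<beta>] hd[of j \<gamma>] ij by auto
        then show False using ij by auto
      qed
      then show "?f i ` perms_132_last_not_max i \<inter> ?f j ` perms_132_last_not_max j = {}" by blast
    qed
  qed auto
  also have "\<dots> = (\<Sum>m=1..<Suc n. card (perms_132_last_not_max m))"
    by (intro sum.cong refl card_image inj_onI) simp
  finally show ?thesis
    using indec_not_last_max_eq[of "Suc n"] sum_card_perms_132_last_not_max[of n] by simp
qed

section \<open>Skew-indecomposable 132-avoiders\<close>

text \<open>An entry before \<open>n\<close> smaller than an entry after \<open>n\<close> would form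
  a 132 with it, so a cut is possible right after \<open>n\<close> unless \<open>n\<close> is
  last.\<close>

lemma indec_132_last_max: "{\<pi> \<in> indec_perms n {[1, 3, 2]}. last \<pi> \<noteq> n} = {}"
proof (rule ccontr)
  assume "\<not> ?thesis"
  then obtain \<pi> where pi: "\<pi> \<in> avoiding_perms n {[1, 3, 2]}" "skew_indec \<pi>" "last \<pi> \<noteq> n"
    by (auto simp: indec_perms_def)
  have ne: "\<pi> \<noteq> []" using pi(2) by (simp add: skew_indec_def)
  have set: "set \<pi> = {1..n}" and dist: "distinct \<pi>" and av: "\<not> contains_132 \<pi>"
    using pi(1) avoids_132 by (auto simp: avoiding_perms_iff)
  \<comment> \<open>Nonemptiness of \<open>\<pi>\<close> rules out \<open>n = 0\<close>.\<close>
  have "n \<in> set \<pi>" using hd_in_set[OF ne] unfolding set by auto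
  then obtain L R where s: "\<pi> = L @ n # R" by (meson split_list)
  have R: "R \<noteq> []" using pi(3) s by auto
  have "above (L @ [n]) R"
    unfolding above_def
  proof (intro ballI)
    fix x y assume x: "x \<in> set (L @ [n])" and y: "y \<in> set R"
    have "y \<in> {1..n}" "y \<noteq> n" using y dist set s by auto
    then have yn: "y < n" by simp
    show "y < x"
    proof (rule ccontr)
      assume "\<not> y < x"
      then have xL: "x \<in> set L" "x < y" using x y yn dist s by (auto simp: order.strict_iff_order)
      have "subseq ([x] @ [n] @ [y]) (L @ [n] @ R)"
        by (intro list_emb_append_mono) (simp_all add: subseq_singleton_left xL y)
      then have "contains_132 \<pi>"
        unfolding contains_132_def s using xL(2) yn by (metis append_Cons append_Nil)
      then show False using av by blast
    qed
  qed
  moreover have "\<pi> = (L @ [n]) @ R" using s by simp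
  ultimately show False using pi(2) R unfolding skew_indec_def by blast
qed

section \<open>Generating functions\<close>

definition indec_gf :: "nat list set \<Rightarrow> real fps" where
  "indec_gf T = Abs_fps (\<lambda>n. real (card (indec_perms n T)))"

lemma indec_perms_0: "indec_perms 0 T = {}"
  by (auto simp: indec_perms_def avoiding_perms_iff skew_indec_def)

lemma avoiding_gf_skew:
  assumes "\<forall>\<tau>\<in>T. skew_indec \<tau>"
  shows "avoiding_gf T = 1 + indec_gf T * avoiding_gf T"
proof (rule fps_ext)
  fix n
  show "fps_nth (avoiding_gf T) n = fps_nth (1 + indec_gf T * avoiding_gf T) n"
  proof (cases "n = 0")
    case True
    have "[] \<notin> T" using assms by (auto simp: skew_indec_def)
    then show ?thesis
      using True by (simp add: avoiding_gf_def indec_gf_def card_avoiding_perms_0 indec_perms_0)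
  next
    case False
    \<comment> \<open>The convolution has an extra term at index 0, which vanishes because no
      indecomposable is empty.\<close>
    have "{0..n} = insert 0 {1..n}" by auto
    then have "fps_nth (indec_gf T * avoiding_gf T) n =
        real (\<Sum>k=1..n. card (indec_perms k T) * card (avoiding_perms (n - k) T))"
      by (simp add: fps_mult_nth avoiding_gf_def indec_gf_def indec_perms_0)
    then show ?thesis
      using False card_avoiding_perms_skew[OF assms, of n] by (simp add: avoiding_gf_def)
  qed
qed

lemma indec_gf_132: "indec_gf {[1, 3, 2]} = fps_X * avoiding_gf {[1, 3, 2]}"
proof (rule fps_ext)
  fix n
  show "fps_nth (indec_gf {[1, 3, 2]}) n = fps_nth (fps_X * avoiding_gf {[1, 3, 2]}) n"
  proof (cases "n = 0")
    case False
    then show ?thesis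
      using card_indec_perms[of "{[1, 3, 2]}" n]
      unfolding indec_132_last_max by (simp add: indec_gf_def avoiding_gf_def)
  qed (simp add: indec_gf_def indec_perms_0)
qed

text \<open>The difference of the two equations factors as \<open>f - g\<close> times a series with
  constant term 1, and formal power series over the reals have no zero divisors.\<close>

lemma fps_unique_quadratic:
  fixes f g :: "real fps"
  assumes "f = 1 + fps_X * f\<^sup>2" "g = 1 + fps_X * g\<^sup>2"
  shows "f = g"
proof -
  have "f - g = fps_X * f\<^sup>2 - fps_X * g\<^sup>2" using assms by (metis add_diff_cancel_left)
  then have "(f - g) * (1 - fps_X * (f + g)) = 0"
    by (simp add: algebra_simps power2_eq_square)
  moreover have "1 - fps_X * (f + g) \<noteq> 0"
  proof
    assume "1 - fps_X * (f + g) = 0"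
    then have "fps_nth (1 - fps_X * (f + g)) 0 = 0" by simp
    then show False by simp
  qed
  ultimately show ?thesis by simp
qed

text \<open>Squaring \<open>catalan_gf_mult\<close>, solved for the root, removes the radical; the
  factor \<open>4 * fps_X\<close> then cancels.\<close>

lemma catalan_gf_quadratic: "catalan_gf = 1 + fps_X * catalan_gf\<^sup>2"
proof -
  let ?C = "catalan_gf"
  have "(1 - 2 * fps_X * ?C)\<^sup>2 = 1 - 4 * fps_X"
    unfolding catalan_gf_mult by (simp add: fps_sqrt_squared)
  then have "(4 * fps_X) * (?C - (1 + fps_X * ?C\<^sup>2)) = 0"
    by (simp add: algebra_simps power2_eq_square)
  moreover have "4 * fps_X \<noteq> (0 :: real fps)" by simp
  ultimately show ?thesis by simp
qed

lemma avoiding_gf_132: "avoiding_gf {[1, 3, 2]} = catalan_gf"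
proof (rule fps_unique_quadratic[OF _ catalan_gf_quadratic])
  have "avoiding_gf {[1, 3, 2]} = 1 + fps_X * avoiding_gf {[1, 3, 2]} * avoiding_gf {[1, 3, 2]}"
    using avoiding_gf_skew[of "{[1, 3, 2]}"] skew_indec_132 unfolding indec_gf_132 by blast
  then show "avoiding_gf {[1, 3, 2]} = 1 + fps_X * (avoiding_gf {[1, 3, 2]})\<^sup>2"
    by (simp add: power2_eq_square mult.assoc)
qed

text \<open>Those ending in their maximum give the first summand. The others of length
  \<open>m + 1\<close> number one less than the 132-avoiders of length \<open>m\<close>; subtracting
  this one for every \<open>m\<close> amounts to the geometric series.\<close>

lemma indec_gf_separable:
  fixes T
  defines "T \<equiv> {[1, 2, 4, 3], [2, 4, 1, 3], [3, 1, 4, 2]}"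
  shows "indec_gf T = fps_X * (avoiding_gf T + catalan_gf - Abs_fps (\<lambda>_. 1))"
proof (rule fps_ext)
  fix n
  show "fps_nth (indec_gf T) n = fps_nth (fps_X * (avoiding_gf T + catalan_gf - Abs_fps (\<lambda>_. 1))) n"
  proof (cases n)
    case (Suc m)
    have "\<forall>\<tau>\<in>T. \<tau> \<noteq> [] \<and> (\<exists>y\<in>set \<tau>. last \<tau> < y)" by (auto simp: T_def)
    from card_indec_perms[OF this, of n]
    have "real (card (indec_perms n T)) =
        real (card (avoiding_perms m T)) + (real (card (avoiding_perms m {[1, 3, 2]})) - 1)"
      using Suc card_indec_not_last_max[of m] unfolding T_def by simp
    then show ?thesis
      using Suc by (simp add: indec_gf_def avoiding_gf_def flip: avoiding_gf_132)
  qed (simp add: indec_gf_def indec_perms_0)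
qed

theorem theorem3p34:
  shows "avoiding_gf {[1,2,4,3], [2,4,1,3], [3,1,4,2]} =
    (1 - fps_X * (1 - fps_X) * catalan_gf
       - fps_sqrt (1 - 5 * fps_X + 10 * fps_X^2 - 5 * fps_X^3
                     - fps_X * (1 - fps_X) * (1 + fps_X) * catalan_gf))
    / (2 * fps_X * (1 - fps_X))"
proof -
  define T :: "nat list set" where "T = {[1, 2, 4, 3], [2, 4, 1, 3], [3, 1, 4, 2]}"
  define F where "F = avoiding_gf T"
  define G :: "real fps" where "G = Abs_fps (\<lambda>_. 1)"
  define X :: "real fps" where "X = fps_X"
  define C where "C = catalan_gf"
  define D where "D = 1 - 5 * X + 10 * X^2 - 5 * X^3 - X * (1 - X) * (1 + X) * C"
  have G: "(1 - X) * G = 1"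
    unfolding G_def X_def by (rule fps_ext) (simp add: left_diff_distrib)
  have C: "X * C\<^sup>2 = C - 1"
    using catalan_gf_quadratic unfolding C_def X_def by (metis add_diff_cancel_left')
  have "F = 1 + X * (F + C - G) * F"
    using avoiding_gf_skew[of T] skew_indec_patterns indec_gf_separable
    unfolding F_def T_def C_def G_def X_def by auto
  \<comment> \<open>Multiplication by \<open>1 - X\<close> eliminates the geometric series
    \<open>G\<close>, leaving a quadratic equation for \<open>F\<close> with coefficients in
    \<open>X\<close> and \<open>C\<close>.\<close>
  then have "(1 - X) * F = (1 - X) * (1 + X * (F + C - G) * F)" by (rule arg_cong)
  also have "\<dots> = (1 - X) + (1 - X) * X * F * (F + C) - X * F * ((1 - X) * G)"
    by (simp add: algebra_simps)
  finally have F: "F = (1 - X) + X * (1 - X) * F * (F + C)"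
    unfolding G by (simp add: algebra_simps)
  \<comment> \<open>Completing the square: with \<open>A = X * (1 - X)\<close> and
    \<open>B = 1 - A * C\<close> the equation reads \<open>A * F^2 - B * F + (1 - X) = 0\<close>,
    and \<open>S = B - 2 * A * F\<close> squares to the discriminant
    \<open>B^2 - 4 * A * (1 - X)\<close>. Replacing \<open>X * C^2\<close> by \<open>C - 1\<close>
    turns this into \<open>D\<close>.\<close>
  define S where "S = 1 - X * (1 - X) * C - 2 * X * (1 - X) * F"
  have "S\<^sup>2 - D = 4 * X * (1 - X) * ((1 - X) + X * (1 - X) * F * (F + C) - F) +
      X * (1 - X)\<^sup>2 * (X * C\<^sup>2 - (C - 1))"
    unfolding S_def D_def by (simp add: algebra_simps power2_eq_square power3_eq_cube)
  also have "\<dots> = 0" using F C by simp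
  finally have "S\<^sup>2 = D" by simp
  moreover have "(fps_sqrt D)\<^sup>2 = D"
    by (rule fps_sqrt_squared) (simp add: D_def X_def)
  ultimately have "(S - fps_sqrt D) * (S + fps_sqrt D) = 0"
    by (simp add: algebra_simps power2_eq_square)
  \<comment> \<open>The sign of the root is settled by constant terms: both \<open>S\<close> and
    \<open>fps_sqrt D\<close> start with 1, so their sum starts with 2.\<close>
  moreover have "S + fps_sqrt D \<noteq> 0"
  proof
    assume "S + fps_sqrt D = 0"
    then have "fps_nth (S + fps_sqrt D) 0 = 0" by simp
    then show False by (simp add: S_def D_def X_def fps_sqrt_nth_0)
  qed
  ultimately have "S = fps_sqrt D" by simp
  then have "1 - X * (1 - X) * C - fps_sqrt D = F * (2 * X * (1 - X))"
    by (simp add: S_def algebra_simps flip: \<open>S = fps_sqrt D\<close>)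
  \<comment> \<open>The numerator is \<open>F\<close> times this divisor, so the division is exact
    once the divisor is nonzero.\<close>
  moreover have "2 * X * (1 - X) \<noteq> 0"
  proof -
    have "fps_nth (1 - X) 0 \<noteq> 0" by (simp add: X_def)
    then have "1 - X \<noteq> 0" by (metis fps_zero_nth)
    then show ?thesis by (simp add: X_def)
  qed
  ultimately have "F = (1 - X * (1 - X) * C - fps_sqrt D) / (2 * X * (1 - X))"
    by simp
  then show ?thesis
    unfolding F_def T_def D_def C_def X_def .
qed

end
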